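(* The greedy algorithm is a $5$-approximation for the unweighted stochastic matching problem.
   Context: Stochastic matching problem (edge-probing model). An instance consists of an undirected graph $G=(V,E)$, a probability $p_e\in[0,1]$ for every edge $e$, and a positive integer patience $t_v$ for each vertex $v$. Each edge $e$ is independently present with probability $p_e$, revealed only when probed. A (possibly adaptive) strategy repeatedly probes a not-yet-probed edge $(u,v)$ with $u,v$ unmatched and with positive remaining patience (initially $t_u,t_v$): with probability $p_e$ the edge is added to the matching and $u,v$ become matched; otherwise the remaining patience of $u$ and $v$ decreases by $1$. A vertex has timed out if $t_v$ edges incident to it have been probed. In the unweighted problem the value is the expected number of matched edges; a strategy is an $\alpha$-approximation if its expected value is at least $1/\alpha$ times the maximum expected value of any adaptive strategy. The greedy algorithm orders the edges by non-increasing $p_e$ and considers them in this order, probing an edge if and only if neither endpoint is matched or timed out at that moment. *)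

theory Defs
  imports "HOL-Probability.Probability"
begin

locale stochastic_matching_instance =
  fixes V :: "'a set" and E :: "'a set set" and p :: "'a set \<Rightarrow> real" and t :: "'a \<Rightarrow> nat"
  assumes finite_vertices: "finite V"
    and edges: "\<And>e. e \<in> E \<Longrightarrow> \<exists>u\<in>V. \<exists>v\<in>V. u \<noteq> v \<and> e = {u, v}"
    and probs: "\<And>e. e \<in> E \<Longrightarrow> 0 \<le> p e \<and> p e \<le> 1"
    and patience: "\<And>v. v \<in> V \<Longrightarrow> 0 < t v"

text \<open>
  An adaptive strategy is a decision tree: \<open>Probe e s f\<close> probes \<open>e\<close> and continues with \<open>s\<close> if
  \<open>e\<close> turns out to be present and with \<open>f\<close> otherwise.
\<close>

datatype 'a strategy = Stop | Probe "'a set" "'a strategy" "'a strategy"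

text \<open>
  Below, \<open>P\<close> is the set of edges probed so far and \<open>M \<subseteq> P\<close> the current matching.  As long as \<open>v\<close> is
  unmatched, all probes of edges at \<open>v\<close> have failed, so the remaining patience of \<open>v\<close> is \<open>t v\<close>
  minus the number of probed edges at \<open>v\<close>.
\<close>

definition matched :: "'a set set \<Rightarrow> 'a \<Rightarrow> bool" where
  "matched M v \<longleftrightarrow> (\<exists>e\<in>M. v \<in> e)"

definition timed_out :: "('a \<Rightarrow> nat) \<Rightarrow> 'a set set \<Rightarrow> 'a \<Rightarrow> bool" where
  "timed_out t P v \<longleftrightarrow> t v \<le> card {e \<in> P. v \<in> e}"

definition can_probe :: "('a \<Rightarrow> nat) \<Rightarrow> 'a set set \<Rightarrow> 'a set set \<Rightarrow> 'a set \<Rightarrow> bool" where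
  "can_probe t P M e \<longleftrightarrow> (\<forall>v\<in>e. \<not> matched M v \<and> \<not> timed_out t P v)"

primrec admissible_from ::
  "'a set set \<Rightarrow> ('a \<Rightarrow> nat) \<Rightarrow> 'a set set \<Rightarrow> 'a set set \<Rightarrow> 'a strategy \<Rightarrow> bool" where
  "admissible_from E t P M Stop \<longleftrightarrow> True"
| "admissible_from E t P M (Probe e s f) \<longleftrightarrow>
     e \<in> E \<and> e \<notin> P \<and> can_probe t P M e \<and>
     admissible_from E t (insert e P) (insert e M) s \<and>
     admissible_from E t (insert e P) M f"

definition admissible :: "'a set set \<Rightarrow> ('a \<Rightarrow> nat) \<Rightarrow> 'a strategy \<Rightarrow> bool" where
  "admissible E t s \<longleftrightarrow> admissible_from E t {} {} s"

definition present_edges :: "'a set set \<Rightarrow> ('a set \<Rightarrow> real) \<Rightarrow> ('a set \<Rightarrow> bool) pmf" where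
  "present_edges E p = Pi_pmf E False (\<lambda>e. bernoulli_pmf (p e))"

primrec matching_of :: "'a strategy \<Rightarrow> ('a set \<Rightarrow> bool) \<Rightarrow> 'a set set" where
  "matching_of Stop X = {}"
| "matching_of (Probe e s f) X =
     (if X e then insert e (matching_of s X) else matching_of f X)"

definition expected_value :: "'a set set \<Rightarrow> ('a set \<Rightarrow> real) \<Rightarrow> 'a strategy \<Rightarrow> real" where
  "expected_value E p s =
     measure_pmf.expectation (present_edges E p) (\<lambda>X. real (card (matching_of s X)))"

definition opt_value :: "'a set set \<Rightarrow> ('a set \<Rightarrow> real) \<Rightarrow> ('a \<Rightarrow> nat) \<Rightarrow> real" where
  "opt_value E p t = Max (expected_value E p ` {s. admissible E t s})"

definition is_approximation ::
  "'a set set \<Rightarrow> ('a set \<Rightarrow> real) \<Rightarrow> ('a \<Rightarrow> nat) \<Rightarrow> real \<Rightarrow> 'a strategy \<Rightarrow> bool" where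
  "is_approximation E p t \<alpha> s \<longleftrightarrow>
     admissible E t s \<and> expected_value E p s \<ge> 1 / \<alpha> * opt_value E p t"

primrec greedy_from ::
  "('a \<Rightarrow> nat) \<Rightarrow> 'a set set \<Rightarrow> 'a set set \<Rightarrow> 'a set list \<Rightarrow> 'a strategy" where
  "greedy_from t P M [] = Stop"
| "greedy_from t P M (e # es) =
     (if can_probe t P M e
      then Probe e (greedy_from t (insert e P) (insert e M) es) (greedy_from t (insert e P) M es)
      else greedy_from t P M es)"

definition greedy :: "('a \<Rightarrow> nat) \<Rightarrow> 'a set list \<Rightarrow> 'a strategy" where
  "greedy t es = greedy_from t {} {} es"

text \<open>Ties between edges of equal probability may be broken arbitrarily.\<close>

definition greedy_order :: "'a set set \<Rightarrow> ('a set \<Rightarrow> real) \<Rightarrow> 'a set list \<Rightarrow> bool" where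
  "greedy_order E p es \<longleftrightarrow>
     distinct es \<and> set es = E \<and> sorted_wrt (\<lambda>e f. p e \<ge> p f) es"

text \<open>There are only finitely many admissible strategies, so the maximum in \<open>opt_value\<close> is genuine.\<close>

lemma finite_admissible_from:
  assumes "finite E"
  shows "finite {s. admissible_from E t P M s}"
proof (induction "card (E - P)" arbitrary: P M rule: less_induct)
  case less
  let ?A = "\<lambda>P M. {s. admissible_from E t P M s}"
  let ?B = "\<Union>e\<in>E - P. (\<lambda>(s, f). Probe e s f) `
              (?A (insert e P) (insert e M) \<times> ?A (insert e P) M)"
  have "finite (?A (insert e P) N)" if "e \<in> E - P" for e N
  proof (rule less)
    show "card (E - insert e P) < card (E - P)"
      using that assms by (intro psubset_card_mono) auto
  qed
  then have "finite (insert Stop ?B)"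
    using assms by auto
  moreover have "?A P M \<subseteq> insert Stop ?B"
  proof
    fix s assume "s \<in> ?A P M"
    then show "s \<in> insert Stop ?B" by (cases s) auto
  qed
  ultimately show ?case by (rule rev_finite_subset)
qed

lemma (in stochastic_matching_instance) finite_edges: "finite E"
  using finite_vertices edges by (auto intro!: finite_subset[of E "Pow V"])

lemma (in stochastic_matching_instance) finite_admissible: "finite {s. admissible E t s}"
  using finite_admissible_from[OF finite_edges] by (simp add: admissible_def)

lemma admissible_Stop: "admissible E t Stop"
  by (simp add: admissible_def)

lemma (in stochastic_matching_instance) opt_value_attained:
  "\<exists>s. admissible E t s \<and> expected_value E p s = opt_value E p t"
proof -
  have "opt_value E p t \<in> expected_value E p ` {s. admissible E t s}"
    unfolding opt_value_def using finite_admissible admissible_Stop by (intro Max_in) auto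
  then show ?thesis by auto
qed

lemma (in stochastic_matching_instance) expected_value_le_opt_value:
  "admissible E t s \<Longrightarrow> expected_value E p s \<le> opt_value E p t"
  unfolding opt_value_def using finite_admissible by (intro Max_ge) auto

end

theory Submission
  imports Defs
begin

text \<open>
  The probing probabilities \<open>y\<close> of any admissible strategy satisfy the linear constraints
  \<open>y\<^sub>e \<le> 1\<close>, \<open>\<Sum>\<^sub>e\<^sub>\<ni>\<^sub>v p\<^sub>e y\<^sub>e \<le> 1\<close> and \<open>\<Sum>\<^sub>e\<^sub>\<ni>\<^sub>v y\<^sub>e \<le> t\<^sub>v\<close>, and its value is \<open>\<Sum>\<^sub>e p\<^sub>e y\<^sub>e\<close>.  For every
  outcome of greedy, with set \<open>P\<close> of probed edges and matching \<open>M\<close>, a feasible solution of the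
  dual program charges \<open>p\<^sub>e\<close> to every probed edge, \<open>1\<close> to every matched vertex, and the average
  \<open>\<beta>\<^sub>v = (\<Sum>\<^sub>e\<^sub>\<in>\<^sub>P\<^sub>,\<^sub>e\<^sub>\<ni>\<^sub>v p\<^sub>e) / t\<^sub>v\<close> per unit of patience to \<open>v\<close>: an edge blocked by a timed-out vertex
  \<open>v\<close> comes after the \<open>t\<^sub>v\<close> probed edges at \<open>v\<close>, so its probability is at most \<open>\<beta>\<^sub>v\<close>.  The dual
  value is at most \<open>2 |M| + 3 (\<Sum>\<^sub>e\<^sub>\<in>\<^sub>P p\<^sub>e)\<close>, whose expectation is five times the value of greedy.
\<close>

section \<open>Recursions on decision trees\<close>

primrec strategy_value :: "('a set \<Rightarrow> real) \<Rightarrow> 'a strategy \<Rightarrow> real" where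
  "strategy_value p Stop = 0"
| "strategy_value p (Probe e s f) =
     p e * (1 + strategy_value p s) + (1 - p e) * strategy_value p f"

primrec probe_prob :: "('a set \<Rightarrow> real) \<Rightarrow> 'a strategy \<Rightarrow> 'a set \<Rightarrow> real" where
  "probe_prob p Stop d = 0"
| "probe_prob p (Probe e s f) d =
     (if d = e then 1 else 0) + p e * probe_prob p s d + (1 - p e) * probe_prob p f d"

lemma matched_insert [simp]: "matched (insert e M) v \<longleftrightarrow> v \<in> e \<or> matched M v"
  by (auto simp: matched_def)

text \<open>Later probes only concern edges outside \<open>P\<close>, so the presence of
  \<open>e\<close> is never read again. This is where independence of the remaining tree from past
  outcomes enters.\<close>

lemma matching_of_upd:
  assumes "admissible_from E t P M s" "e \<in> P"
  shows "matching_of s (X(e := b)) = matching_of s X"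
  using assms by (induction s arbitrary: P M) auto

lemma matching_of_subset:
  assumes "admissible_from E t P M s"
  shows "matching_of s X \<subseteq> E - P"
  using assms
proof (induction s arbitrary: P M)
  case (Probe e s f)
  then show ?case
    using Probe.IH(1)[of "insert e P" "insert e M"] Probe.IH(2)[of "insert e P" M] by auto
qed simp

text \<open>One recursion serves the objective and both vertex constraints: the weight
  \<open>g\<close> is \<open>p\<close> for the value and for matching probabilities, and constantly
  1 for patience.\<close>

lemma sum_probe_prob:
  assumes "finite F"
  shows "(\<Sum>d\<in>F. g d * probe_prob p (Probe e s f) d) =
    (if e \<in> F then g e else 0) + p e * (\<Sum>d\<in>F. g d * probe_prob p s d)
      + (1 - p e) * (\<Sum>d\<in>F. g d * probe_prob p f d)"
proof -
  have "(\<Sum>d\<in>F. g d * probe_prob p (Probe e s f) d) =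
    (\<Sum>d\<in>F. (if d = e then g d else 0) + p e * (g d * probe_prob p s d)
      + (1 - p e) * (g d * probe_prob p f d))"
    by (rule sum.cong) (auto simp: algebra_simps)
  also have "\<dots> = (if e \<in> F then g e else 0) + p e * (\<Sum>d\<in>F. g d * probe_prob p s d)
      + (1 - p e) * (\<Sum>d\<in>F. g d * probe_prob p f d)"
    using assms by (simp add: sum.distrib sum_distrib_left)
  finally show ?thesis .
qed

lemma greedy_from_admissible:
  assumes "distinct es" "set es \<subseteq> E - P"
  shows "admissible_from E t P M (greedy_from t P M es)"
  using assms
proof (induction es arbitrary: P M)
  case (Cons e es)
  have "admissible_from E t (insert e P) N (greedy_from t (insert e P) N es)" for N
    using Cons.prems by (intro Cons.IH) auto
  moreover have "admissible_from E t P M (greedy_from t P M es)"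
    using Cons.prems by (intro Cons.IH) auto
  ultimately show ?case using Cons.prems by simp
qed simp

section \<open>The value of a strategy as a linear function of its probing probabilities\<close>

context stochastic_matching_instance
begin

lemma edge_subset: "e \<in> E \<Longrightarrow> e \<subseteq> V"
  using edges by blast

lemma card_edge: "e \<in> E \<Longrightarrow> card e = 2"
  using edges by (metis card_2_iff)

lemma finite_edge: "e \<in> E \<Longrightarrow> finite e"
  using edge_subset finite_vertices finite_subset by blast

text \<open>\<open>strategy_value\<close> tosses a fresh coin at every probe. This agrees with the
  product measure because an admissible tree never repeats an edge: the coordinate of the root edge
  splits off, and neither subtree reads it.\<close>

lemma expectation_matching_of:
  assumes "admissible_from E t P M s"
  shows "measure_pmf.expectation (Pi_pmf (E - P) False (\<lambda>e. bernoulli_pmf (p e)))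
           (\<lambda>X. real (card (matching_of s X))) = strategy_value p s"
  using assms
proof (induction s arbitrary: P M)
  case (Probe e s f)
  define A where "A = E - insert e P"
  define Q where "Q = Pi_pmf A False (\<lambda>e. bernoulli_pmf (p e))"
  have e: "e \<in> E" "e \<notin> P"
    and s: "admissible_from E t (insert e P) (insert e M) s"
    and f: "admissible_from E t (insert e P) M f"
    using Probe.prems by auto
  have pe: "0 \<le> p e" "p e \<le> 1"
    using probs e by auto
  have finA: "finite A" and EP: "E - P = insert e A"
    using finite_edges e by (auto simp: A_def)
  \<comment> \<open>Finite support settles all integrability conditions below.\<close>
  have finQ: "finite (set_pmf Q)"
    unfolding Q_def using finA
    by (intro finite_subset[OF set_Pi_pmf_subset' finite_PiE_dflt]) auto
  have int: "integrable (measure_pmf Q) g" for g :: "_ \<Rightarrow> real"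
    using finQ by (rule integrable_measure_pmf_finite)
  have card_s: "card (matching_of (Probe e s f) (X(e := True))) = Suc (card (matching_of s X))" for X
  proof -
    have "matching_of s X \<subseteq> E - insert e P"
      using matching_of_subset[OF s] .
    moreover from this have "finite (matching_of s X)"
      using finite_edges finite_subset by blast
    ultimately show ?thesis
      by (subst matching_of.simps) (auto simp: matching_of_upd[OF s] card_insert_if)
  qed
  have card_f: "card (matching_of (Probe e s f) (X(e := False))) = card (matching_of f X)" for X
    by (simp add: matching_of_upd[OF f])
  let ?h = "\<lambda>X. real (card (matching_of (Probe e s f) X))"
  have "measure_pmf.expectation (Pi_pmf (E - P) False (\<lambda>e. bernoulli_pmf (p e))) ?h =
      measure_pmf.expectation
        (bernoulli_pmf (p e) \<bind> (\<lambda>b. map_pmf (\<lambda>X. X(e := b)) Q)) ?h"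
    unfolding EP Q_def using finA
    by (subst Pi_pmf_insert') (auto simp: A_def map_pmf_def)
  also have "\<dots> = (\<Sum>b\<in>UNIV. pmf (bernoulli_pmf (p e)) b *\<^sub>R
      measure_pmf.expectation (map_pmf (\<lambda>X. X(e := b)) Q) ?h)"
    by (rule pmf_expectation_bind) (use finQ in auto)
  also have "\<dots> = p e * measure_pmf.expectation Q (\<lambda>X. 1 + real (card (matching_of s X)))
      + (1 - p e) * measure_pmf.expectation Q (\<lambda>X. real (card (matching_of f X)))"
    using pe by (simp add: UNIV_bool card_s card_f del: matching_of.simps)
  also have "measure_pmf.expectation Q (\<lambda>X. 1 + real (card (matching_of s X)))
      = 1 + measure_pmf.expectation Q (\<lambda>X. real (card (matching_of s X)))"
    by (subst Bochner_Integration.integral_add) (auto intro: int)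
  finally show ?case
    using Probe.IH(1)[OF s] Probe.IH(2)[OF f] by (simp add: Q_def A_def)
qed simp

lemma expected_value_eq:
  assumes "admissible E t s"
  shows "expected_value E p s = strategy_value p s"
  using expectation_matching_of[of "{}" "{}" s] assms
  by (simp add: expected_value_def present_edges_def admissible_def)

lemma strategy_value_eq_sum_probe_prob:
  assumes "admissible_from E t P M s"
  shows "strategy_value p s = (\<Sum>e\<in>E. p e * probe_prob p s e)"
  using assms
proof (induction s arbitrary: P M)
  case (Probe e s f)
  from Probe.prems have "strategy_value p s = (\<Sum>e\<in>E. p e * probe_prob p s e)"
    "strategy_value p f = (\<Sum>e\<in>E. p e * probe_prob p f e)" "e \<in> E"
    by (auto intro: Probe.IH)
  then show ?case
    unfolding sum_probe_prob[OF finite_edges] by (simp add: algebra_simps)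
qed simp

section \<open>Linear constraints on the probing probabilities\<close>

lemma probe_prob_nonneg:
  assumes "admissible_from E t P M s"
  shows "0 \<le> probe_prob p s d"
  using assms
proof (induction s arbitrary: P M)
  case (Probe e s f)
  from Probe.prems have "0 \<le> probe_prob p s d" "0 \<le> probe_prob p f d" "0 \<le> p e" "p e \<le> 1"
    using probs[of e] by (auto intro: Probe.IH)
  then show ?case by simp
qed simp

text \<open>The bound 0 for edges already probed makes the induction work: once \<open>d\<close> is
  probed at the root, both subtrees contribute nothing more.\<close>

lemma probe_prob_le_1:
  assumes "admissible_from E t P M s"
  shows "probe_prob p s d \<le> (if d \<in> P then 0 else 1)"
  using assms
proof (induction s arbitrary: P M)
  case (Probe e s f)
  have p: "0 \<le> p e" "p e \<le> 1"
    using Probe.prems probs[of e] by auto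
  have "probe_prob p s d \<le> (if d \<in> insert e P then 0 else 1)"
    using Probe.prems by (intro Probe.IH(1)) auto
  moreover have "probe_prob p f d \<le> (if d \<in> insert e P then 0 else 1)"
    using Probe.prems by (intro Probe.IH(2)) auto
  ultimately have "p e * probe_prob p s d + (1 - p e) * probe_prob p f d
      \<le> (if d \<in> insert e P then 0 else 1)"
    using p by (intro convex_bound_le) auto
  then show ?case
    using Probe.prems by (auto split: if_splits)
qed simp

text \<open>Each summand is the probability that \<open>e\<close> is probed and present, and at most
  one edge at \<open>v\<close> can enter the matching. The value 0 for a matched \<open>v\<close>
  strengthens the induction.\<close>

lemma sum_probability_le_1:
  assumes "admissible_from E t P M s"
  shows "(\<Sum>e | e \<in> E \<and> v \<in> e. p e * probe_prob p s e) \<le> (if matched M v then 0 else 1)"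
  using assms
proof (induction s arbitrary: P M)
  case (Probe e s f)
  let ?S = "\<lambda>s. \<Sum>e | e \<in> E \<and> v \<in> e. p e * probe_prob p s e"
  have p: "0 \<le> p e" "p e \<le> 1"
    using Probe.prems probs[of e] by auto
  have s: "?S s \<le> (if matched (insert e M) v then 0 else 1)"
    using Probe.prems by (intro Probe.IH(1)) auto
  have f: "?S f \<le> (if matched M v then 0 else 1)"
    using Probe.prems by (intro Probe.IH(2)) auto
  have eq: "?S (Probe e s f) = (if v \<in> e then p e else 0) + p e * ?S s + (1 - p e) * ?S f"
    using Probe.prems finite_edges by (subst sum_probe_prob) auto
  show ?case
  proof (cases "v \<in> e")
    case True
    then have "\<not> matched M v"
      using Probe.prems by (auto simp: can_probe_def)
    \<comment> \<open>A success at \<open>e\<close> matches \<open>v\<close>, so that branch adds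
      nothing, and the total is at most \<open>p e + (1 - p e) = 1\<close>.\<close>
    moreover have "p e * ?S s \<le> p e * 0"
      using True s p by (intro mult_left_mono) auto
    moreover have "(1 - p e) * ?S f \<le> (1 - p e) * 1"
      using f p \<open>\<not> matched M v\<close> by (intro mult_left_mono) auto
    ultimately show ?thesis unfolding eq using True by simp
  next
    case False
    then have "p e * ?S s + (1 - p e) * ?S f \<le> (if matched M v then 0 else 1)"
      using s f p by (intro convex_bound_le) auto
    then show ?thesis unfolding eq using False by simp
  qed
qed simp

text \<open>The bound is the remaining patience, which every probe at \<open>v\<close> lowers by one
  whatever its outcome.\<close>

lemma sum_probe_prob_le:
  assumes "admissible_from E t P M s" "finite P"
    and "card {e \<in> P. v \<in> e} \<le> t v"
  shows "(\<Sum>e | e \<in> E \<and> v \<in> e. probe_prob p s e) \<le> real (t v) - real (card {e \<in> P. v \<in> e})"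
  using assms
proof (induction s arbitrary: P M)
  case (Probe e s f)
  let ?S = "\<lambda>s. \<Sum>e | e \<in> E \<and> v \<in> e. probe_prob p s e"
  let ?c = "\<lambda>P. card {e \<in> P. v \<in> e}"
  have p: "0 \<le> p e" "p e \<le> 1"
    using Probe.prems probs[of e] by auto
  \<comment> \<open>The strict inequality leaves room for one more probe at \<open>v\<close>, so the
    cardinality hypothesis passes to both subtrees.\<close>
  have e: "e \<in> E" "e \<notin> P" "v \<in> e \<Longrightarrow> ?c P < t v"
    using Probe.prems by (auto simp: can_probe_def timed_out_def)
  have c: "?c (insert e P) = (if v \<in> e then Suc (?c P) else ?c P)"
  proof -
    have "{d \<in> insert e P. v \<in> d} = (if v \<in> e then insert e {d \<in> P. v \<in> d} else {d \<in> P. v \<in> d})"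
      by auto
    then show ?thesis using e Probe.prems by simp
  qed
  have le: "?c (insert e P) \<le> t v"
    using c e Probe.prems by auto
  have "?S s \<le> real (t v) - real (?c (insert e P))"
    using Probe.prems le by (intro Probe.IH(1)[where M = "insert e M"]) auto
  moreover have "?S f \<le> real (t v) - real (?c (insert e P))"
    using Probe.prems le by (intro Probe.IH(2)[where M = M]) auto
  ultimately have "p e * ?S s + (1 - p e) * ?S f
      \<le> real (t v) - real (if v \<in> e then Suc (?c P) else ?c P)"
    unfolding c using p by (intro convex_bound_le) auto
  moreover have "?S (Probe e s f) = (if v \<in> e then 1 else 0) + p e * ?S s + (1 - p e) * ?S f"
    using e finite_edges
      sum_probe_prob[of "{e \<in> E. v \<in> e}" "\<lambda>_. 1" p e s f] by simp
  ultimately show ?case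
    by (simp del: probe_prob.simps split: if_splits)
qed simp

section \<open>Double counting over endpoints and the dual bound\<close>

lemma sum_incident_eq:
  fixes g :: "'a set \<Rightarrow> real"
  assumes "P \<subseteq> E"
  shows "(\<Sum>v\<in>V. \<Sum>e | e \<in> P \<and> v \<in> e. g e) = 2 * (\<Sum>e\<in>P. g e)"
proof -
  have finP: "finite P"
    using assms finite_edges finite_subset by blast
  have "(\<Sum>v\<in>V. \<Sum>e | e \<in> P \<and> v \<in> e. g e) = (\<Sum>e\<in>P. \<Sum>v | v \<in> V \<and> v \<in> e. g e)"
    using finP finite_vertices by (rule sum.swap_restrict[rotated])
  also have "\<dots> = (\<Sum>e\<in>P. 2 * g e)"
  proof (rule sum.cong)
    fix e assume "e \<in> P"
    then have "e \<in> E" using assms by auto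
    then have "{v \<in> V. v \<in> e} = e"
      using edge_subset by auto
    then show "(\<Sum>v | v \<in> V \<and> v \<in> e. g e) = 2 * g e"
      using card_edge[OF \<open>e \<in> E\<close>] by simp
  qed simp
  finally show ?thesis by (simp add: sum_distrib_left)
qed

lemma card_matched_le:
  assumes "M \<subseteq> E"
  shows "card {v \<in> V. matched M v} \<le> 2 * card M"
proof -
  have finM: "finite M"
    using assms finite_edges finite_subset by blast
  have "card {v \<in> V. matched M v} \<le> card (\<Union>M)"
    using finM assms finite_edge by (intro card_mono) (auto simp: matched_def)
  also have "\<dots> \<le> (\<Sum>e\<in>M. card e)"
    by (rule card_Union_le_sum_card)
  also have "\<dots> = (\<Sum>e\<in>M. 2)"
    using assms card_edge by (intro sum.cong) auto
  finally show ?thesis by simp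
qed

text \<open>In the coefficient 3, one unit is the charge on probed edges; the other two come from
  the patience terms \<open>\<beta> v * t v\<close>, which count each probed edge once per endpoint.
  Matched vertices give the 2.\<close>

lemma weak_duality:
  assumes adm: "admissible E t s" and P: "P \<subseteq> E" and M: "M \<subseteq> E"
    and blocked: "\<And>e. e \<in> E - P \<Longrightarrow>
      \<exists>v\<in>e. matched M v \<or> timed_out t P v \<and> (\<forall>d\<in>P. v \<in> d \<longrightarrow> p e \<le> p d)"
  shows "strategy_value p s \<le> 2 * card M + 3 * (\<Sum>e\<in>P. p e)"
proof -
  define y where "y = probe_prob p s"
  define \<alpha> :: "'a \<Rightarrow> real" where "\<alpha> v = (if matched M v then 1 else 0)" for v
  define \<beta> where "\<beta> v = (\<Sum>e | e \<in> P \<and> v \<in> e. p e) / t v" for v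
  have adm': "admissible_from E t {} {} s"
    using adm by (simp add: admissible_def)
  have y0: "0 \<le> y e" and y1: "y e \<le> 1" for e
    using probe_prob_nonneg[OF adm', of e] probe_prob_le_1[OF adm', of e] by (auto simp: y_def)
  have py: "(\<Sum>e | e \<in> E \<and> v \<in> e. p e * y e) \<le> 1" for v
    using sum_probability_le_1[OF adm'] by (auto simp: y_def matched_def)
  have ty: "(\<Sum>e | e \<in> E \<and> v \<in> e. y e) \<le> t v" for v
    using sum_probe_prob_le[OF adm', of v] by (auto simp: y_def)
  have p0: "0 \<le> p e" if "e \<in> E" for e
    using probs that by auto
  have finP: "finite P"
    using P finite_edges finite_subset by blast
  have \<alpha>0: "0 \<le> \<alpha> v" for v
    by (simp add: \<alpha>_def)
  have \<beta>0: "0 \<le> \<beta> v" for v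
    unfolding \<beta>_def using p0 P by (intro divide_nonneg_nonneg sum_nonneg) auto
  \<comment> \<open>The dual constraint of \<open>e\<close>, already multiplied by
    \<open>y e\<close>; for an edge outside \<open>P\<close> a single blocking endpoint
    suffices.\<close>
  have feasible: "p e * y e \<le> (if e \<in> P then p e else 0) + (\<Sum>v\<in>e. \<alpha> v * (p e * y e) + \<beta> v * y e)"
    if e: "e \<in> E" for e
  proof -
    have nn: "0 \<le> \<alpha> v * (p e * y e) + \<beta> v * y e" for v
      using \<alpha>0 \<beta>0 y0 p0[OF e] by simp
    show ?thesis
    proof (cases "e \<in> P")
      case True
      have "p e * y e \<le> p e"
        using y1 p0[OF e] by (simp add: mult_left_le)
      moreover have "0 \<le> (\<Sum>v\<in>e. \<alpha> v * (p e * y e) + \<beta> v * y e)"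
        using nn by (intro sum_nonneg)
      ultimately show ?thesis using True by simp
    next
      case False
      then obtain v where v: "v \<in> e"
        and or: "matched M v \<or> timed_out t P v \<and> (\<forall>d\<in>P. v \<in> d \<longrightarrow> p e \<le> p d)"
        using blocked e by blast
      have "p e * y e \<le> \<alpha> v * (p e * y e) + \<beta> v * y e"
      proof (cases "matched M v")
        case True
        then show ?thesis using \<beta>0 y0 by (simp add: \<alpha>_def)
      next
        case False
        with or have to: "t v \<le> card {d \<in> P. v \<in> d}" and le: "\<forall>d\<in>P. v \<in> d \<longrightarrow> p e \<le> p d"
          by (auto simp: timed_out_def)
        \<comment> \<open>At least \<open>t v\<close> probed edges at \<open>v\<close> have
          probability at least \<open>p e\<close>, so dividing their sum by \<open>t v\<close>
          yields at least \<open>p e\<close>.\<close>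
        have "p e * t v \<le> p e * card {d \<in> P. v \<in> d}"
          using to p0[OF e] by (intro mult_left_mono) auto
        also have "\<dots> = (\<Sum>d | d \<in> P \<and> v \<in> d. p e)"
          by simp
        also have "\<dots> \<le> (\<Sum>d | d \<in> P \<and> v \<in> d. p d)"
          using le by (intro sum_mono) auto
        finally have "p e \<le> \<beta> v"
          using patience[of v] v edge_subset[OF e] by (auto simp: \<beta>_def field_simps)
        then show ?thesis
          using y0 False by (simp add: \<alpha>_def mult_right_mono)
      qed
      also have "\<dots> \<le> (\<Sum>v\<in>e. \<alpha> v * (p e * y e) + \<beta> v * y e)"
        using v nn finite_edge[OF e] by (intro member_le_sum) auto
      finally show ?thesis using False by simp
    qed
  qed
  have "strategy_value p s = (\<Sum>e\<in>E. p e * y e)"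
    using strategy_value_eq_sum_probe_prob[OF adm'] by (simp add: y_def)
  also have "\<dots> \<le> (\<Sum>e\<in>E. (if e \<in> P then p e else 0) + (\<Sum>v\<in>e. \<alpha> v * (p e * y e) + \<beta> v * y e))"
    using feasible by (rule sum_mono)
  also have "\<dots> = (\<Sum>e\<in>P. p e)
      + (\<Sum>e\<in>E. \<Sum>v | v \<in> V \<and> v \<in> e. \<alpha> v * (p e * y e) + \<beta> v * y e)"
  proof -
    have "(\<Sum>e\<in>E. if e \<in> P then p e else 0) = (\<Sum>e\<in>P. p e)"
      using P finite_edges by (simp add: sum.If_cases Int_absorb1)
    moreover have "{v \<in> V. v \<in> e} = e" if "e \<in> E" for e
      using edge_subset[OF that] by auto
    ultimately show ?thesis by (simp add: sum.distrib)
  qed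
  also have "(\<Sum>e\<in>E. \<Sum>v | v \<in> V \<and> v \<in> e. \<alpha> v * (p e * y e) + \<beta> v * y e)
      = (\<Sum>v\<in>V. \<Sum>e | e \<in> E \<and> v \<in> e. \<alpha> v * (p e * y e) + \<beta> v * y e)"
    using finite_edges finite_vertices by (rule sum.swap_restrict)
  also have "\<dots> = (\<Sum>v\<in>V. \<alpha> v * (\<Sum>e | e \<in> E \<and> v \<in> e. p e * y e)
      + \<beta> v * (\<Sum>e | e \<in> E \<and> v \<in> e. y e))"
    by (simp add: sum.distrib sum_distrib_left)
  also have "\<dots> \<le> (\<Sum>v\<in>V. \<alpha> v * 1 + \<beta> v * t v)"
    using py ty \<alpha>0 \<beta>0 by (intro sum_mono add_mono mult_left_mono)
  also have "\<dots> = card {v \<in> V. matched M v} + (\<Sum>v\<in>V. \<Sum>e | e \<in> P \<and> v \<in> e. p e)"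
  proof -
    have "(\<Sum>v\<in>V. \<alpha> v) = card {v \<in> V. matched M v}"
      using finite_vertices by (simp add: \<alpha>_def sum.If_cases Int_def)
    moreover have "(\<Sum>v\<in>V. \<beta> v * t v) = (\<Sum>v\<in>V. \<Sum>e | e \<in> P \<and> v \<in> e. p e)"
      using patience by (intro sum.cong) (auto simp: \<beta>_def)
    ultimately show ?thesis by (simp add: sum.distrib)
  qed
  finally show ?thesis
    using card_matched_le[OF M] sum_incident_eq[OF P, of p] by simp
qed

section \<open>Analysis of greedy and the approximation ratio\<close>

text \<open>The dual bound is averaged over the remaining run. A probe of \<open>e\<close> costs
  \<open>3 * p e\<close> for certain and 2 more with probability \<open>p e\<close>, so
  \<open>5 * p e\<close> in expectation. The last two hypotheses are the invariant that ends in the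
  blocking condition of \<open>weak_duality\<close>.\<close>

lemma greedy_from_bound:
  assumes "admissible E t s" and "P \<subseteq> E" "M \<subseteq> E" "set es \<subseteq> E - P" "distinct es"
    and "sorted_wrt (\<lambda>e f. p e \<ge> p f) es"
    and "\<And>d e. d \<in> P \<Longrightarrow> e \<in> set es \<Longrightarrow> p e \<le> p d"
    and "\<And>e. e \<in> E - P - set es \<Longrightarrow>
      \<exists>v\<in>e. matched M v \<or> timed_out t P v \<and> (\<forall>d\<in>P. v \<in> d \<longrightarrow> p e \<le> p d)"
  shows "strategy_value p s \<le>
    2 * card M + 3 * (\<Sum>e\<in>P. p e) + 5 * strategy_value p (greedy_from t P M es)"
  using assms(2-)
proof (induction es arbitrary: P M)
  case Nil
  then show ?case using weak_duality[OF assms(1)] by simp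
next
  case (Cons e es)
  have fin: "finite P" "finite M"
    using Cons.prems finite_edges finite_subset by blast+
  show ?case
  proof (cases "can_probe t P M e")
    case False
    have "strategy_value p s \<le>
      2 * card M + 3 * (\<Sum>e\<in>P. p e) + 5 * strategy_value p (greedy_from t P M es)"
    proof (rule Cons.IH)
      fix d assume d: "d \<in> E - P - set es"
      show "\<exists>v\<in>d. matched M v \<or> timed_out t P v \<and> (\<forall>c\<in>P. v \<in> c \<longrightarrow> p d \<le> p c)"
      proof (cases "d = e")
        \<comment> \<open>The skipped edge has a matched or timed-out endpoint, and all edges probed
          before it have at least its probability.\<close>
        case True
        then show ?thesis
          using False Cons.prems(6) by (auto simp: can_probe_def)
      next
        case False
        then show ?thesis using Cons.prems(7)[of d] d by auto
      qed
    qed (use Cons.prems in auto)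
    then show ?thesis using False by simp
  next
    case True
    have e: "e \<in> E" "e \<notin> P"
      using Cons.prems by auto
    have p: "0 \<le> p e" "p e \<le> 1"
      using probs e by auto
    \<comment> \<open>\<open>N\<close> stands for the matching after either outcome:
      \<open>insert e M\<close> or \<open>M\<close>.\<close>
    have step: "strategy_value p s \<le> 2 * card N + 3 * (p e + (\<Sum>e\<in>P. p e))
        + 5 * strategy_value p (greedy_from t (insert e P) N es)"
      if N: "M \<subseteq> N" "N \<subseteq> E" for N
    proof -
      have "strategy_value p s \<le> 2 * card N + 3 * (\<Sum>e\<in>insert e P. p e)
        + 5 * strategy_value p (greedy_from t (insert e P) N es)"
      proof (rule Cons.IH)
        fix d assume "d \<in> E - insert e P - set es"
        then obtain v where v: "v \<in> d"
          "matched M v \<or> timed_out t P v \<and> (\<forall>c\<in>P. v \<in> c \<longrightarrow> p d \<le> p c)"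
          using Cons.prems(7)[of d] by auto
        have "matched N v" if "matched M v"
          using that N by (auto simp: matched_def)
        \<comment> \<open>The new probe avoids timed-out vertices, so the probed edges at such a
          \<open>v\<close> are unchanged and \<open>v\<close> still blocks \<open>d\<close>.\<close>
        moreover have "v \<notin> e" "timed_out t (insert e P) v" if "timed_out t P v"
        proof -
          show "v \<notin> e"
            using True that by (auto simp: can_probe_def)
          then have "{d \<in> insert e P. v \<in> d} = {d \<in> P. v \<in> d}"
            by auto
          then show "timed_out t (insert e P) v"
            using that by (simp add: timed_out_def)
        qed
        ultimately show "\<exists>v\<in>d. matched N v \<or>
            timed_out t (insert e P) v \<and> (\<forall>c\<in>insert e P. v \<in> c \<longrightarrow> p d \<le> p c)"
          using v by blast
      qed (use Cons.prems N in auto)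
      then show ?thesis using e fin by simp
    qed
    let ?A = "strategy_value p (greedy_from t (insert e P) (insert e M) es)"
    let ?B = "strategy_value p (greedy_from t (insert e P) M es)"
    let ?c = "2 * real (card M) + 3 * (p e + (\<Sum>e\<in>P. p e))"
    have "card (insert e M) \<le> Suc (card M)"
      using fin by (simp add: card_insert_if)
    then have "strategy_value p s \<le> ?c + 2 + 5 * ?A"
      using step[OF subset_insertI, of e] e Cons.prems by (auto simp: distrib_left)
    moreover have "strategy_value p s \<le> ?c + 5 * ?B"
      using step[of M] Cons.prems by auto
    \<comment> \<open>Both bounds hold for the same left side, so they may be mixed with weights
      \<open>p e\<close> and \<open>1 - p e\<close>.\<close>
    ultimately have
      "p e * strategy_value p s + (1 - p e) * strategy_value p s
        \<le> p e * (?c + 2 + 5 * ?A) + (1 - p e) * (?c + 5 * ?B)"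
      using p by (intro add_mono mult_left_mono) auto
    then show ?thesis using True by (simp add: algebra_simps)
  qed
qed

end

theorem theorem5:
  fixes V :: "'a set" and E :: "'a set set" and p :: "'a set \<Rightarrow> real" and t :: "'a \<Rightarrow> nat"
    and es :: "'a set list"
  assumes "stochastic_matching_instance V E p t"
    and "greedy_order E p es"
  shows "is_approximation E p t 5 (greedy t es)"
proof -
  interpret stochastic_matching_instance V E p t by fact
  have es: "distinct es" "set es = E" "sorted_wrt (\<lambda>e f. p e \<ge> p f) es"
    using assms(2) by (auto simp: greedy_order_def)
  have adm: "admissible E t (greedy t es)"
    unfolding admissible_def greedy_def using es by (intro greedy_from_admissible) auto
  obtain s where s: "admissible E t s" "expected_value E p s = opt_value E p t"
    using opt_value_attained by blast
  have "strategy_value p s \<le> 2 * card ({} :: 'a set set) + 3 * (\<Sum>e\<in>{}. p e)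
      + 5 * strategy_value p (greedy_from t {} {} es)"
    using s(1) es by (intro greedy_from_bound) auto
  then have "opt_value E p t \<le> 5 * expected_value E p (greedy t es)"
    using s expected_value_eq[OF s(1)] expected_value_eq[OF adm] by (simp add: greedy_def)
  then show ?thesis
    using adm by (simp add: is_approximation_def)
qed

end
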